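(* Let $A_1,B_1,C_1\in\mathbb{R}^{n\times n}$ and $A_2,B_2,C_2\in\mathbb{R}^{m\times m}$ be symmetric matrices such that $C_2$ and $C_1\otimes B_2-B_1\otimes C_2$ are positive definite and $C_1$ is negative definite. Let $(i,j)$ be either $(1,1)$ or $(n,m)$, and assume that the eigenvalue of index $(i,j)$ of the two-parameter eigenvalue problem $$(A_1+\lambda B_1+\mu C_1)u=0,\qquad (A_2+\lambda B_2+\mu C_2)v=0$$ is simple. Let $(u_k)$, $(v_k)$ be sequences generated by the alternating algorithm (described in the context) with input index $(i,j)$, started from an arbitrary nonzero $u_0\in\mathbb{R}^n$. Then $u_k$ and $v_k$ converge, up to normalization and sign flip, to a solution of the two-parameter eigenvalue problem; that is, there are unit vectors $u\in\mathbb{R}^n$, $v\in\mathbb{R}^m$, signs $s_k,t_k\in\{-1,1\}$ and real numbers $\lambda,\mu$ such that $s_k u_k/\|u_k\|\to u$, $t_k v_k/\|v_k\|\to v$, and $(A_1+\lambda B_1+\mu C_1)u=0$, $(A_2+\lambda B_2+\mu C_2)v=0$.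
   Context: Notation: $a_1(u)=u^\top A_1u$, $b_1(u)=u^\top B_1u$, $c_1(u)=u^\top C_1u$, $a_2(v)=v^\top A_2v$, $b_2(v)=v^\top B_2v$, $c_2(v)=v^\top C_2v$. The tensor product $\otimes$ of matrices is the Kronecker product. An eigenvalue of the two-parameter eigenvalue problem is a pair $(\lambda,\mu)$ for which nonzero $u,v$ solving both equations exist. It has index $(i,j)$ if $0$ is the $i$-th smallest eigenvalue of $A_1+\lambda B_1+\mu C_1$ and the $j$-th smallest eigenvalue of $A_2+\lambda B_2+\mu C_2$ (eigenvalues counted with multiplicity; if $0$ is a multiple eigenvalue, $(\lambda,\mu)$ has several indices). It is a known fact that, under the stated assumptions on the matrices, for each $(i,j)\in\{1,\dots,n\}\times\{1,\dots,m\}$ there is exactly one eigenvalue of index $(i,j)$. The eigenvalue is simple if its eigenvector $u\otimes v$ is unique up to scaling, i.e. if the kernels of $A_1+\lambda B_1+\mu C_1$ and $A_2+\lambda B_2+\mu C_2$ are both one-dimensional. Alternating algorithm with input index $(i,j)$: start from a nonzero $u_0\in\mathbb{R}^n$. For $k=1,2,3,\dots$: (1) with $a_1=a_1(u_{k-1})$, $b_1=b_1(u_{k-1})$, $c_1=c_1(u_{k-1})$, let $v_k\neq0$ be an eigenvector for the $j$-th smallest eigenvalue of the generalized eigenvalue problem $(a_1C_2-c_1A_2)v=\lambda(c_1B_2-b_1C_2)v$; (2) with $a_2=a_2(v_k)$, $b_2=b_2(v_k)$, $c_2=c_2(v_k)$, let $\lambda_k$ be the $i$-th smallest eigenvalue,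 and $u_k\neq0$ a corresponding eigenvector, of the generalized eigenvalue problem $(c_2A_1-a_2C_1)u=\lambda(b_2C_1-c_2B_1)u$. Under the stated assumptions the right-hand side matrices are positive definite, so these generalized eigenvalues are real; they are ordered and counted with multiplicity. *)

theory Defs
  imports "HOL-Analysis.Analysis"
begin

definition quad_form :: "real^'k^'k \<Rightarrow> real^'k \<Rightarrow> real" where
  "quad_form M x = x \<bullet> (M *v x)"

definition symmetric_mat :: "real^'k^'k \<Rightarrow> bool" where
  "symmetric_mat M \<longleftrightarrow> transpose M = M"

definition pos_def :: "real^'k^'k \<Rightarrow> bool" where
  "pos_def M \<longleftrightarrow> symmetric_mat M \<and> (\<forall>x. x \<noteq> 0 \<longrightarrow> quad_form M x > 0)"

definition neg_def :: "real^'k^'k \<Rightarrow> bool" where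
  "neg_def M \<longleftrightarrow> symmetric_mat M \<and> (\<forall>x. x \<noteq> 0 \<longrightarrow> quad_form M x < 0)"

text \<open>Rows and columns of a Kronecker product are indexed by pairs.\<close>

definition kronecker :: "real^'n^'n \<Rightarrow> real^'m^'m \<Rightarrow> real^('n \<times> 'm)^('n \<times> 'm)"
    (infixl "\<otimes>\<^sub>K" 70) where
  "A \<otimes>\<^sub>K B = (\<chi> p q. A $ fst p $ fst q * B $ snd p $ snd q)"

definition mat_kernel :: "real^'k^'k \<Rightarrow> (real^'k) set" where
  "mat_kernel M = {x. M *v x = 0}"

text \<open>
  The generalized eigenvalue problem for the pair \<open>(M, N)\<close> is \<open>M x = \<kappa> N x\<close>; the ordinary
  eigenvalue problem is the case \<open>N = mat 1\<close>.  All pairs considered here have \<open>M\<close> symmetric and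
  \<open>N\<close> symmetric positive definite, so that geometric and algebraic multiplicities agree.
\<close>

definition eigenspace :: "real^'k^'k \<Rightarrow> real^'k^'k \<Rightarrow> real \<Rightarrow> (real^'k) set" where
  "eigenspace M N \<kappa> = {x. M *v x = \<kappa> *\<^sub>R (N *v x)}"

text \<open>
  The list \<open>xs\<close> consists of all eigenvalues in nondecreasing order, each repeated according to its
  multiplicity; a real number that is not an eigenvalue has an eigenspace of dimension 0 and hence
  does not occur in it.  Such a list is unique, and its entry number \<open>i\<close>, counted from 1, is the
  \<open>i\<close>-th smallest eigenvalue.
\<close>

definition sorted_eigenvalues :: "real^'k^'k \<Rightarrow> real^'k^'k \<Rightarrow> real list \<Rightarrow> bool" where
  "sorted_eigenvalues M N xs \<longleftrightarrow>
     sorted xs \<and> (\<forall>\<kappa>. count_list xs \<kappa> = dim (eigenspace M N \<kappa>))"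

definition ith_smallest_eigenvalue ::
    "nat \<Rightarrow> real^'k^'k \<Rightarrow> real^'k^'k \<Rightarrow> real \<Rightarrow> bool" where
  "ith_smallest_eigenvalue i M N \<kappa> \<longleftrightarrow>
     (\<exists>xs. sorted_eigenvalues M N xs \<and> 1 \<le> i \<and> i \<le> length xs \<and> xs ! (i - 1) = \<kappa>)"

definition pencil ::
    "real^'k^'k \<Rightarrow> real^'k^'k \<Rightarrow> real^'k^'k \<Rightarrow> real \<Rightarrow> real \<Rightarrow> real^'k^'k" where
  "pencil A B C lam mu = A + lam *\<^sub>R B + mu *\<^sub>R C"

definition two_param_eigenvalue ::
    "real^'n^'n \<Rightarrow> real^'n^'n \<Rightarrow> real^'n^'n \<Rightarrow> real^'m^'m \<Rightarrow> real^'m^'m \<Rightarrow> real^'m^'m \<Rightarrow>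
     real \<Rightarrow> real \<Rightarrow> bool" where
  "two_param_eigenvalue A1 B1 C1 A2 B2 C2 lam mu \<longleftrightarrow>
     (\<exists>u v. u \<noteq> 0 \<and> v \<noteq> 0 \<and>
            pencil A1 B1 C1 lam mu *v u = 0 \<and> pencil A2 B2 C2 lam mu *v v = 0)"

definition eigenvalue_of_index ::
    "real^'n^'n \<Rightarrow> real^'n^'n \<Rightarrow> real^'n^'n \<Rightarrow> real^'m^'m \<Rightarrow> real^'m^'m \<Rightarrow> real^'m^'m \<Rightarrow>
     nat \<Rightarrow> nat \<Rightarrow> real \<Rightarrow> real \<Rightarrow> bool" where
  "eigenvalue_of_index A1 B1 C1 A2 B2 C2 i j lam mu \<longleftrightarrow>
     two_param_eigenvalue A1 B1 C1 A2 B2 C2 lam mu \<and>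
     ith_smallest_eigenvalue i (pencil A1 B1 C1 lam mu) (mat 1) 0 \<and>
     ith_smallest_eigenvalue j (pencil A2 B2 C2 lam mu) (mat 1) 0"

definition simple_eigenvalue ::
    "real^'n^'n \<Rightarrow> real^'n^'n \<Rightarrow> real^'n^'n \<Rightarrow> real^'m^'m \<Rightarrow> real^'m^'m \<Rightarrow> real^'m^'m \<Rightarrow>
     real \<Rightarrow> real \<Rightarrow> bool" where
  "simple_eigenvalue A1 B1 C1 A2 B2 C2 lam mu \<longleftrightarrow>
     two_param_eigenvalue A1 B1 C1 A2 B2 C2 lam mu \<and>
     dim (mat_kernel (pencil A1 B1 C1 lam mu)) = 1 \<and>
     dim (mat_kernel (pencil A2 B2 C2 lam mu)) = 1"

definition v_step ::
    "real^'n^'n \<Rightarrow> real^'n^'n \<Rightarrow> real^'n^'n \<Rightarrow> real^'m^'m \<Rightarrow> real^'m^'m \<Rightarrow> real^'m^'m \<Rightarrow>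
     nat \<Rightarrow> real^'n \<Rightarrow> real^'m \<Rightarrow> bool" where
  "v_step A1 B1 C1 A2 B2 C2 j u v \<longleftrightarrow>
     (let a = quad_form A1 u; b = quad_form B1 u; c = quad_form C1 u;
          M = a *\<^sub>R C2 - c *\<^sub>R A2; N = c *\<^sub>R B2 - b *\<^sub>R C2
      in \<exists>\<kappa>. ith_smallest_eigenvalue j M N \<kappa> \<and> v \<noteq> 0 \<and> v \<in> eigenspace M N \<kappa>)"

definition u_step ::
    "real^'n^'n \<Rightarrow> real^'n^'n \<Rightarrow> real^'n^'n \<Rightarrow> real^'m^'m \<Rightarrow> real^'m^'m \<Rightarrow> real^'m^'m \<Rightarrow>
     nat \<Rightarrow> real^'m \<Rightarrow> real^'n \<Rightarrow> bool" where
  "u_step A1 B1 C1 A2 B2 C2 i v u \<longleftrightarrow>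
     (let a = quad_form A2 v; b = quad_form B2 v; c = quad_form C2 v;
          M = c *\<^sub>R A1 - a *\<^sub>R C1; N = b *\<^sub>R C1 - c *\<^sub>R B1
      in \<exists>\<kappa>. ith_smallest_eigenvalue i M N \<kappa> \<and> u \<noteq> 0 \<and> u \<in> eigenspace M N \<kappa>)"

text \<open>The algorithm produces no \<open>v 0\<close>; that value is left unconstrained.\<close>

definition alternating_algorithm ::
    "real^'n^'n \<Rightarrow> real^'n^'n \<Rightarrow> real^'n^'n \<Rightarrow> real^'m^'m \<Rightarrow> real^'m^'m \<Rightarrow> real^'m^'m \<Rightarrow>
     nat \<Rightarrow> nat \<Rightarrow> (nat \<Rightarrow> real^'n) \<Rightarrow> (nat \<Rightarrow> real^'m) \<Rightarrow> bool" where
  "alternating_algorithm A1 B1 C1 A2 B2 C2 i j u v \<longleftrightarrow>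
     u 0 \<noteq> 0 \<and>
     (\<forall>k\<ge>1. v_step A1 B1 C1 A2 B2 C2 j (u (k - 1)) (v k) \<and>
             u_step A1 B1 C1 A2 B2 C2 i (v k) (u k))"

end

theory Submission
  imports Defs
begin

text \<open>
  The alternating algorithm with index \<open>(1, 1)\<close> is alternating minimization of the quotient
  \[ \rho(u,v) = \frac{a_1(u) c_2(v) - c_1(u) a_2(v)}{c_1(u) b_2(v) - b_1(u) c_2(v)}, \]
  so its values decrease. A limit point \<open>(u, v)\<close> of the normalized iterates minimizes the quotient
  in each variable separately. Since both pencils at the eigenvalue \<open>(\<lambda>\<^sub>0, \<mu>\<^sub>0)\<close> of index \<open>(1, 1)\<close>
  are positive semidefinite, \<open>\<lambda>\<^sub>0\<close> is the global minimum of the quotient, and separate minimality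
  already forces \<open>\<rho>(u, v) = \<lambda>\<^sub>0\<close>. Then both pencil forms vanish at \<open>u\<close> and \<open>v\<close>, so these lie in
  the one-dimensional kernels; all limit points thus agree up to sign. The index \<open>(n, m)\<close> reduces
  to \<open>(1, 1)\<close> by negating \<open>A\<^sub>1\<close> and \<open>A\<^sub>2\<close>.
\<close>

subsection \<open>Quadratic forms\<close>

lemma matrix_vector_mult_uminus_left: "(- A) *v x = - (A *v x)" for A :: "real^'n^'m"
  by (metis add.right_inverse matrix_vector_mult_0 matrix_vector_mult_add_rdistrib minus_unique)

lemma quad_form_simps:
  "quad_form (A + B) x = quad_form A x + quad_form B x"
  "quad_form (A - B) x = quad_form A x - quad_form B x"
  "quad_form (- A) x = - quad_form A x"
  "quad_form (c *\<^sub>R A) x = c * quad_form A x"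
  "quad_form (mat 1) x = x \<bullet> x"
  by (simp_all add: quad_form_def matrix_vector_mult_add_rdistrib matrix_vector_mult_diff_rdistrib
      matrix_vector_mult_uminus_left inner_add_right inner_diff_right
      scaleR_matrix_vector_assoc[symmetric])

lemma quad_form_pencil:
  "quad_form (pencil A B C lam mu) x = quad_form A x + lam * quad_form B x + mu * quad_form C x"
  by (simp add: pencil_def quad_form_simps)

lemma quad_form_scaleR: "quad_form A (c *\<^sub>R x) = c\<^sup>2 * quad_form A x"
  by (simp add: quad_form_def matrix_vector_mult_scaleR power2_eq_square)

lemma tendsto_quad_form [tendsto_intros]:
  "(f \<longlongrightarrow> x) F \<Longrightarrow> ((\<lambda>k. quad_form A (f k)) \<longlongrightarrow> quad_form A x) F"
  unfolding quad_form_def by (intro tendsto_inner bounded_linear.tendsto[OF matrix_vector_mul_bounded_linear])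

lemma continuous_on_quad_form: "continuous_on S (quad_form A)"
  unfolding continuous_on_def by (auto intro!: tendsto_intros)

lemma symmetric_mat_simps:
  "symmetric_mat A \<Longrightarrow> symmetric_mat B \<Longrightarrow> symmetric_mat (A + B)"
  "symmetric_mat A \<Longrightarrow> symmetric_mat B \<Longrightarrow> symmetric_mat (A - B)"
  "symmetric_mat A \<Longrightarrow> symmetric_mat (- A)"
  "symmetric_mat A \<Longrightarrow> symmetric_mat (c *\<^sub>R A)"
  "symmetric_mat (mat 1)"
  by (auto simp: symmetric_mat_def transpose_def vec_eq_iff mat_def)

lemma symmetric_mat_inner:
  "symmetric_mat A \<Longrightarrow> x \<bullet> (A *v y) = (A *v x) \<bullet> y"
  by (metis dot_lmul_matrix symmetric_mat_def vector_transpose_matrix)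

text \<open>A zero of a nonnegative form is a minimum, hence a critical point: if
  \<open>A *v x\<close> were nonzero, a short step from \<open>x\<close> against this gradient
  direction would make the form negative.\<close>

lemma quad_form_eq_0_imp_kernel:
  assumes sym: "symmetric_mat A" and nonneg: "\<And>y. quad_form A y \<ge> 0" and x: "quad_form A x = 0"
  shows "A *v x = 0"
proof (rule ccontr)
  define w where "w = A *v x"
  assume "A *v x \<noteq> 0"
  then have ww: "w \<bullet> w > 0" by (simp add: w_def)
  \<comment> \<open>This step length keeps the quadratic term
    \<open>s\<^sup>2 * quad_form A w\<close> at no more than half of the linear decrease
    \<open>2 * s * (w \<bullet> w)\<close>. The summand 1 covers the case
    \<open>quad_form A w = 0\<close>.\<close>
  define s where "s = w \<bullet> w / (quad_form A w + 1)"
  have q: "quad_form A w \<ge> 0" by (rule nonneg)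
  have s: "s > 0" using ww q by (simp add: s_def)
  have "quad_form A (x - s *\<^sub>R w) = quad_form A x - 2 * s * (w \<bullet> w) + s\<^sup>2 * quad_form A w"
    using symmetric_mat_inner[OF sym, of x w]
    by (simp add: quad_form_def w_def matrix_vector_mult_diff_distrib matrix_vector_mult_scaleR
        inner_diff_left inner_diff_right power2_eq_square inner_commute algebra_simps)
  also have "\<dots> = s * (s * quad_form A w - 2 * (w \<bullet> w))"
    using x by (simp add: power2_eq_square algebra_simps)
  also have "s * quad_form A w \<le> w \<bullet> w"
    using q ww by (simp add: s_def field_simps)
  then have "s * (s * quad_form A w - 2 * (w \<bullet> w)) < 0"
    using s ww by (intro mult_pos_neg) linarith+
  finally show False using nonneg[of "x - s *\<^sub>R w"] by simp
qed

section \<open>Kronecker products evaluated at decomposable tensors\<close>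

lemma quad_form_kronecker:
  "quad_form (A \<otimes>\<^sub>K B) (\<chi> p. u $ fst p * v $ snd p) = quad_form A u * quad_form B v"
proof -
  have "quad_form (A \<otimes>\<^sub>K B) (\<chi> p. u $ fst p * v $ snd p)
     = (\<Sum>i\<in>UNIV. \<Sum>j\<in>UNIV. (u $ i * v $ j) * (\<Sum>k\<in>UNIV. \<Sum>l\<in>UNIV. A $ i $ k * B $ j $ l * (u $ k * v $ l)))"
    by (simp add: quad_form_def kronecker_def inner_vec_def matrix_vector_mult_def sum.cartesian_product
        UNIV_Times_UNIV[symmetric] case_prod_beta del: UNIV_Times_UNIV)
  also have "\<dots> = (\<Sum>i\<in>UNIV. \<Sum>j\<in>UNIV. (u $ i * (\<Sum>k\<in>UNIV. A $ i $ k * u $ k)) *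
      (v $ j * (\<Sum>l\<in>UNIV. B $ j $ l * v $ l)))"
  proof (intro sum.cong refl)
    fix i j
    have "(\<Sum>k\<in>UNIV. \<Sum>l\<in>UNIV. A $ i $ k * B $ j $ l * (u $ k * v $ l))
        = (\<Sum>k\<in>UNIV. A $ i $ k * u $ k) * (\<Sum>l\<in>UNIV. B $ j $ l * v $ l)"
      by (simp add: sum_product mult_ac)
    then show "u $ i * v $ j * (\<Sum>k\<in>UNIV. \<Sum>l\<in>UNIV. A $ i $ k * B $ j $ l * (u $ k * v $ l))
        = u $ i * (\<Sum>k\<in>UNIV. A $ i $ k * u $ k) * (v $ j * (\<Sum>l\<in>UNIV. B $ j $ l * v $ l))"
      by simp
  qed
  also have "\<dots> = quad_form A u * quad_form B v"
    by (simp add: sum_product quad_form_def inner_vec_def matrix_vector_mult_def)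
  finally show ?thesis .
qed

text \<open>Positivity of the big matrix is tested at the tensor of \<open>u\<close> and
  \<open>v\<close>, which is nonzero because some product of entries is. The resulting scalar
  inequality makes the denominator of the quotient positive and the right-hand sides of both
  half-steps positive definite.\<close>

lemma pos_def_kronecker_diff:
  assumes "pos_def (C1 \<otimes>\<^sub>K B2 - B1 \<otimes>\<^sub>K C2)" "u \<noteq> 0" "v \<noteq> 0"
  shows "quad_form C1 u * quad_form B2 v - quad_form B1 u * quad_form C2 v > 0"
proof -
  define w where "w = (\<chi> p. u $ fst p * v $ snd p)"
  obtain i j where "u $ i \<noteq> 0" "v $ j \<noteq> 0"
    using assms by (metis vec_eq_iff zero_index)
  then have "w $ (i, j) \<noteq> 0" by (simp add: w_def)
  then have "w \<noteq> 0" by auto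
  then show ?thesis
    using assms(1) by (auto simp: pos_def_def quad_form_simps w_def quad_form_kronecker)
qed

subsection \<open>Extreme generalized eigenvalues\<close>

text \<open>The Rayleigh quotient attains its minimum \<kappa> on the compact unit sphere, and
  homogeneity extends the bound to every \<open>y\<close>. So the form of
  \<open>M - \<kappa> *\<^sub>R N\<close> is nonnegative and vanishes at the minimizer, which
  therefore lies in the kernel.\<close>

lemma rayleigh_minimum:
  fixes M N :: "real^'n^'n"
  assumes M: "symmetric_mat M" and N: "symmetric_mat N" and pos: "\<And>x. x \<noteq> 0 \<Longrightarrow> quad_form N x > 0"
  obtains x \<kappa> where "x \<noteq> 0" "M *v x = \<kappa> *\<^sub>R (N *v x)" "\<And>y. \<kappa> * quad_form N y \<le> quad_form M y"
proof -
  let ?f = "\<lambda>x. quad_form M x / quad_form N x"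
  have nz: "quad_form N x \<noteq> 0" if "x \<in> sphere 0 1" for x
    using pos[of x] that by fastforce
  have "continuous_on (sphere 0 1) ?f"
    by (intro continuous_intros continuous_on_quad_form) (use nz in auto)
  moreover have "axis undefined 1 \<in> sphere (0 :: real^'n) 1" by (simp add: )
  then have "sphere (0 :: real^'n) 1 \<noteq> {}" by blast
  ultimately obtain x where x: "x \<in> sphere 0 1" and le: "\<And>y. y \<in> sphere 0 1 \<Longrightarrow> ?f x \<le> ?f y"
    using continuous_attains_inf[of "sphere 0 1" ?f] by (metis compact_sphere)
  define \<kappa> where "\<kappa> = ?f x"
  have ge: "\<kappa> * quad_form N y \<le> quad_form M y" for y
  proof (cases "y = 0")
    case False
    then have "\<kappa> \<le> ?f (y /\<^sub>R norm y)"
      unfolding \<kappa>_def by (intro le) simp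
    also have "\<dots> = ?f y"
      using False by (simp add: quad_form_scaleR)
    finally show ?thesis
      using pos[OF False] by (simp add: field_simps)
  qed (simp add: quad_form_def)
  have ker: "(M - \<kappa> *\<^sub>R N) *v x = 0"
    by (rule quad_form_eq_0_imp_kernel)
      (use M N ge nz[OF x] in \<open>auto simp: symmetric_mat_simps quad_form_simps \<kappa>_def\<close>)
  show ?thesis
  proof (rule that)
    show "x \<noteq> 0" using x by auto
    have "M *v x - \<kappa> *\<^sub>R (N *v x) = 0"
      using ker by (simp only: matrix_vector_mult_diff_rdistrib scaleR_matrix_vector_assoc)
    then show "M *v x = \<kappa> *\<^sub>R (N *v x)" by (rule eq_iff_diff_eq_0[THEN iffD2])
  qed (rule ge)
qed

lemma subspace_eigenspace: "subspace (eigenspace M N \<kappa>)"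
  unfolding subspace_def eigenspace_def
  by (auto simp: matrix_vector_right_distrib matrix_vector_mult_scaleR scaleR_right_distrib)

text \<open>Serves to bound the total multiplicity of the eigenvalues by the dimension of the space.
  Each further eigenspace meets the span of the previous ones only in 0, so the dimensions add
  up.\<close>

lemma dim_eigenspaces_span:
  fixes M N :: "real^'n^'n"
  assumes M: "symmetric_mat M" and N: "symmetric_mat N" and pos: "\<And>x. x \<noteq> 0 \<Longrightarrow> quad_form N x > 0"
    and "finite K"
  shows "dim (span (\<Union>\<kappa>\<in>K. eigenspace M N \<kappa>)) = (\<Sum>\<kappa>\<in>K. dim (eigenspace M N \<kappa>))"
  using \<open>finite K\<close>
proof (induction K)
  case empty
  show ?case by simp
next
  case (insert \<kappa> K)
  let ?E = "eigenspace M N" and ?S = "span (\<Union>\<kappa>\<in>K. eigenspace M N \<kappa>)"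
  \<comment> \<open>Eigenspaces of different eigenvalues are orthogonal with respect to \<open>N\<close>.\<close>
  have "x = 0" if x: "x \<in> ?E \<kappa>" "x \<in> ?S" for x
  proof -
    have "(N *v x) \<bullet> y = 0" if "y \<in> ?S" for y
      using that
    proof (induction rule: span_induct_alt)
      case (step c z y)
      then obtain \<kappa>' where z: "\<kappa>' \<in> K" "M *v z = \<kappa>' *\<^sub>R (N *v z)"
        by (auto simp: eigenspace_def)
      \<comment> \<open>Moving the symmetric \<open>M\<close> across the inner product produces both
        eigenvalues as factors of the same number; they differ since \<kappa> is not in
        \<open>K\<close>, so that number is 0.\<close>
      have "\<kappa> * ((N *v x) \<bullet> z) = (M *v x) \<bullet> z"
        using x by (simp add: eigenspace_def)
      also have "\<dots> = \<kappa>' * ((N *v x) \<bullet> z)"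
        using symmetric_mat_inner[OF M, of x z] symmetric_mat_inner[OF N, of x z] z by simp
      finally have "(N *v x) \<bullet> z = 0"
        using z insert.hyps by auto
      then show ?case using step by (simp add: inner_add_right)
    qed simp
    then have "quad_form N x = 0"
      using x by (simp add: quad_form_def inner_commute)
    then show "x = 0" using pos[of x] by fastforce
  qed
  then have "?E \<kappa> \<inter> ?S \<subseteq> {0}" by blast
  then have "dim (?E \<kappa> \<inter> ?S) = 0" by (simp only: dim_eq_0)
  moreover have "span (\<Union>\<kappa>\<in>insert \<kappa> K. ?E \<kappa>) = {x + y |x y. x \<in> ?E \<kappa> \<and> y \<in> ?S}"
    by (simp add: span_Un span_eq_iff[THEN iffD2, OF subspace_eigenspace])
  ultimately have "dim (span (\<Union>\<kappa>\<in>insert \<kappa> K. ?E \<kappa>)) = dim (?E \<kappa>) + dim ?S"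
    using dim_sums_Int[OF subspace_eigenspace[of M N \<kappa>] subspace_span[of "\<Union>\<kappa>\<in>K. ?E \<kappa>"]]
    by (simp only: add_0_right)
  then show ?case
    using insert by (simp only: sum.insert[OF insert.hyps])
qed

text \<open>Makes entry number n the last one, hence the largest eigenvalue. The length is the sum
  of the multiplicities, which are dimensions of independent eigenspaces.\<close>

lemma length_sorted_eigenvalues:
  fixes M N :: "real^'n^'n"
  assumes "symmetric_mat M" "symmetric_mat N" "\<And>x. x \<noteq> 0 \<Longrightarrow> quad_form N x > 0"
    and "sorted_eigenvalues M N xs"
  shows "length xs \<le> CARD('n)"
proof -
  have "length xs = (\<Sum>\<kappa>\<in>set xs. count_list xs \<kappa>)"
    by (simp add: sum_count_set)
  also have "\<dots> = dim (span (\<Union>\<kappa>\<in>set xs. eigenspace M N \<kappa>))"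
    using assms by (subst dim_eigenspaces_span) (auto simp: sorted_eigenvalues_def)
  also have "\<dots> \<le> CARD('n)"
    using dim_subset_UNIV[of "span (\<Union>\<kappa>\<in>set xs. eigenspace M N \<kappa>)"] by simp
  finally show ?thesis .
qed

lemma eigenvalue_in_sorted_eigenvalues:
  assumes "sorted_eigenvalues M N xs" "x \<noteq> 0" "M *v x = \<kappa> *\<^sub>R (N *v x)"
  shows "\<kappa> \<in> set xs"
proof -
  have "\<not> eigenspace M N \<kappa> \<subseteq> {0}"
    using assms by (auto simp: eigenspace_def)
  then have "dim (eigenspace M N \<kappa>) \<noteq> 0" by (simp only: dim_eq_0 not_False_eq_True)
  then have "count_list xs \<kappa> \<noteq> 0"
    using assms by (simp add: sorted_eigenvalues_def)
  then show ?thesis by (simp add: count_list_0_iff)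
qed

text \<open>The Rayleigh minimum \<open>l\<close> is an eigenvalue, so it occurs in the sorted list
  and the first entry is at most \<open>l\<close>. The bound for \<open>l\<close> passes on to
  \<kappa> because the form of \<open>N\<close> is nonnegative.\<close>

lemma smallest_eigenvalue_le:
  fixes M N :: "real^'n^'n"
  assumes MN: "symmetric_mat M" "symmetric_mat N" "\<And>x. x \<noteq> 0 \<Longrightarrow> quad_form N x > 0"
    and "ith_smallest_eigenvalue 1 M N \<kappa>"
  shows "\<kappa> * quad_form N y \<le> quad_form M y"
proof -
  obtain xs where xs: "sorted_eigenvalues M N xs" "1 \<le> length xs" "xs ! 0 = \<kappa>"
    using assms by (auto simp: ith_smallest_eigenvalue_def)
  obtain x l where x: "x \<noteq> 0" "M *v x = l *\<^sub>R (N *v x)" "\<And>y. l * quad_form N y \<le> quad_form M y"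
    using rayleigh_minimum[OF MN] by blast
  have "l \<in> set xs"
    using eigenvalue_in_sorted_eigenvalues xs x by blast
  then obtain p where "p < length xs" "xs ! p = l" by (auto simp: in_set_conv_nth)
  then have "\<kappa> \<le> l"
    using xs by (auto simp: sorted_eigenvalues_def intro: sorted_nth_mono[of xs 0 p, simplified])
  moreover have "quad_form N y \<ge> 0"
    using MN(3)[of y] by (cases "y = 0") (auto simp: quad_form_def)
  ultimately show ?thesis
    using x(3)[of y] mult_right_mono by fastforce
qed

lemma largest_eigenvalue_ge:
  fixes M N :: "real^'n^'n"
  assumes MN: "symmetric_mat M" "symmetric_mat N" "\<And>x. x \<noteq> 0 \<Longrightarrow> quad_form N x > 0"
    and "ith_smallest_eigenvalue (CARD('n)) M N \<kappa>"
  shows "quad_form M y \<le> \<kappa> * quad_form N y"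
proof -
  obtain xs where xs: "sorted_eigenvalues M N xs" "CARD('n) \<le> length xs" "xs ! (CARD('n) - 1) = \<kappa>"
    using assms by (auto simp: ith_smallest_eigenvalue_def)
  \<comment> \<open>The entry of index n exists, so the list has at least n entries; the dimension
    bound gives the converse.\<close>
  then have len: "length xs = CARD('n)"
    using length_sorted_eigenvalues[OF MN xs(1)] by simp
  \<comment> \<open>The minimum for \<open>- M\<close> is minus the maximum for \<open>M\<close>, so
    \<open>- l\<close> is the value to compare with the last entry.\<close>
  obtain x l where x: "x \<noteq> 0" "(- M) *v x = l *\<^sub>R (N *v x)"
      "\<And>y. l * quad_form N y \<le> quad_form (- M) y"
    using rayleigh_minimum[of "- M" N] MN symmetric_mat_simps(3) by blast
  have "M *v x = (- l) *\<^sub>R (N *v x)"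
    using x(2) by (simp add: matrix_vector_mult_uminus_left minus_equation_iff[of "M *v x"])
  then have "- l \<in> set xs"
    using eigenvalue_in_sorted_eigenvalues xs x by blast
  then obtain p where "p < length xs" "xs ! p = - l" by (auto simp: in_set_conv_nth)
  then have "- l \<le> \<kappa>"
    using xs len sorted_nth_mono[of xs p "CARD('n) - 1"] by (auto simp: sorted_eigenvalues_def)
  moreover have "quad_form N y \<ge> 0"
    using MN(3)[of y] by (cases "y = 0") (auto simp: quad_form_def)
  ultimately have "- l * quad_form N y \<le> \<kappa> * quad_form N y" by (rule mult_right_mono)
  then show ?thesis using x(3)[of y] by (simp add: quad_form_simps)
qed

subsection \<open>Alternating minimization\<close>

text \<open>Infinitely many terms with \<open>f\<close> far from \<open>c\<close> would, by
  compactness, have a convergent subsequence whose limit contradicts \<open>lim\<close>. The limit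
  points themselves may differ, for instance in sign; only their value under \<open>f\<close> is
  fixed.\<close>

lemma subsequential_limits_imp_tendsto:
  fixes X :: "nat \<Rightarrow> 'a::metric_space" and f :: "'a \<Rightarrow> 'b::metric_space"
  assumes K: "compact K" "\<And>k. X k \<in> K" and f: "continuous_on K f"
    and lim: "\<And>r x. strict_mono r \<Longrightarrow> x \<in> K \<Longrightarrow> (X \<circ> r) \<longlonglongrightarrow> x \<Longrightarrow> f x = c"
  shows "(\<lambda>k. f (X k)) \<longlonglongrightarrow> c"
proof (rule ccontr)
  assume "\<not> ?thesis"
  then obtain e where "e > 0" and "\<forall>N. \<exists>k\<ge>N. dist (f (X k)) c \<ge> e"
    unfolding lim_sequentially by (meson not_less)
  then have "infinite {k. dist (f (X k)) c \<ge> e}"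
    by (simp add: infinite_nat_iff_unbounded_le)
  then obtain r :: "nat \<Rightarrow> nat" where r: "strict_mono r" "\<And>k. dist (f (X (r k))) c \<ge> e"
    using infinite_enumerate by (metis mem_Collect_eq)
  obtain x q where x: "x \<in> K" "strict_mono q" "(X \<circ> r \<circ> q) \<longlonglongrightarrow> x"
    using K by (metis compact_imp_seq_compact seq_compactE comp_apply)
  have "f x = c"
    using lim[of "r \<circ> q" x] x r by (simp add: strict_mono_o o_assoc)
  moreover have "(\<lambda>k. f ((X \<circ> r \<circ> q) k)) \<longlonglongrightarrow> f x"
    by (rule continuous_on_tendsto_compose[OF f x(3)]) (use x K in auto)
  ultimately have "(\<lambda>k. dist (f (X (r (q k)))) c) \<longlonglongrightarrow> 0"
    by (simp add: tendsto_dist_iff[symmetric])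
  then have "e \<le> 0"
    by (rule tendsto_lowerbound) (use r in auto)
  then show False using \<open>e > 0\<close> by simp
qed

lemma unit_vectors_tendsto_up_to_sign:
  fixes x :: "nat \<Rightarrow> 'a::real_inner"
  assumes x: "\<And>k. norm (x k) = 1" and y: "norm y = 1" and lim: "(\<lambda>k. \<bar>x k \<bullet> y\<bar>) \<longlonglongrightarrow> 1"
  obtains s :: "nat \<Rightarrow> real" where "\<And>k. s k \<in> {-1, 1}" "(\<lambda>k. s k *\<^sub>R x k) \<longlonglongrightarrow> y"
proof -
  \<comment> \<open>The sign makes the inner product with \<open>y\<close> nonnegative, so the
    squared distance of two unit vectors depends only on its absolute value.\<close>
  define s :: "nat \<Rightarrow> real" where "s k = (if x k \<bullet> y \<ge> 0 then 1 else -1)" for k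
  have sq: "(norm (s k *\<^sub>R x k - y))\<^sup>2 = 2 - 2 * \<bar>x k \<bullet> y\<bar>" for k
    using x[of k] y by (auto simp: power2_norm_eq_inner inner_diff_left inner_diff_right s_def
        inner_commute norm_eq_1 inner_add_left inner_add_right)
  have "norm (s k *\<^sub>R x k - y) = sqrt (2 - 2 * \<bar>x k \<bullet> y\<bar>)" for k
    unfolding sq[symmetric] by simp
  moreover have "(\<lambda>k. sqrt (2 - 2 * \<bar>x k \<bullet> y\<bar>)) \<longlonglongrightarrow> sqrt (2 - 2 * 1)"
    by (intro tendsto_intros lim)
  ultimately have "(\<lambda>k. norm (s k *\<^sub>R x k - y)) \<longlonglongrightarrow> 0"
    by simp
  then have "(\<lambda>k. s k *\<^sub>R x k) \<longlonglongrightarrow> y"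
    by (rule LIM_zero_cancel[OF tendsto_norm_zero_cancel])
  then show ?thesis using that[of s] by (auto simp: s_def)
qed

text \<open>A line contains just two unit vectors, \<open>y\<close> and \<open>- y\<close>. This
  turns simplicity of the eigenvalue into a condition on limit points that ignores the sign.\<close>

lemma unit_vector_of_1dim_subspace:
  fixes S :: "'a::euclidean_space set"
  assumes "subspace S" "dim S = 1"
  obtains y where "y \<in> S" "norm y = 1" "\<And>x. x \<in> S \<Longrightarrow> norm x = 1 \<Longrightarrow> \<bar>x \<bullet> y\<bar> = 1"
proof -
  obtain B where B: "B \<subseteq> S" "pairwise orthogonal B" "\<And>x. x \<in> B \<Longrightarrow> norm x = 1" "card B = 1" "span B = S"
    using orthonormal_basis_subspace[OF assms(1)] assms(2) by metis
  then obtain y where y: "B = {y}" by (auto simp: card_1_singleton_iff)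
  show ?thesis
  proof
    show "y \<in> S" "norm y = 1" using B y by auto
    fix x assume x: "x \<in> S" "norm x = 1"
    then obtain c where "x = c *\<^sub>R y" using B(5) y by (auto simp: span_singleton)
    then show "\<bar>x \<bullet> y\<bar> = 1" using x \<open>norm y = 1\<close> by (simp add: norm_eq_1)
  qed
qed

text \<open>This is the Rayleigh quotient, at the tensor of \<open>u\<close> and \<open>v\<close>,
  of the generalized eigenvalue problem that remains after eliminating mu:
  \<open>A1 \<otimes>\<^sub>K C2 - C1 \<otimes>\<^sub>K A2\<close> against
  \<open>C1 \<otimes>\<^sub>K B2 - B1 \<otimes>\<^sub>K C2\<close>.\<close>

definition two_param_quotient ::
    "real^'n^'n \<Rightarrow> real^'n^'n \<Rightarrow> real^'n^'n \<Rightarrow> real^'m^'m \<Rightarrow> real^'m^'m \<Rightarrow> real^'m^'m \<Rightarrow>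
     real^'n \<Rightarrow> real^'m \<Rightarrow> real" where
  "two_param_quotient A1 B1 C1 A2 B2 C2 u v =
     (quad_form A1 u * quad_form C2 v - quad_form C1 u * quad_form A2 v) /
     (quad_form C1 u * quad_form B2 v - quad_form B1 u * quad_form C2 v)"

lemma two_param_quotient_scaleR:
  assumes "c \<noteq> 0" "d \<noteq> 0"
  shows "two_param_quotient A1 B1 C1 A2 B2 C2 (c *\<^sub>R u) (d *\<^sub>R v) =
    two_param_quotient A1 B1 C1 A2 B2 C2 u v"
proof -
  let ?n = "quad_form A1 u * quad_form C2 v - quad_form C1 u * quad_form A2 v"
  let ?d = "quad_form C1 u * quad_form B2 v - quad_form B1 u * quad_form C2 v"
  have "two_param_quotient A1 B1 C1 A2 B2 C2 (c *\<^sub>R u) (d *\<^sub>R v) = ((c\<^sup>2 * d\<^sup>2) * ?n) / ((c\<^sup>2 * d\<^sup>2) * ?d)"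
    by (simp add: two_param_quotient_def quad_form_scaleR algebra_simps)
  also have "\<dots> = ?n / ?d" using assms by simp
  finally show ?thesis by (simp add: two_param_quotient_def)
qed

lemma subspace_mat_kernel: "subspace (mat_kernel M)"
  unfolding subspace_def mat_kernel_def
  by (auto simp: matrix_vector_right_distrib matrix_vector_mult_scaleR)

text \<open>Separate minimality is tested only at the kernel vectors \<open>u0\<close> and
  \<open>v0\<close>, one variable at a time. The two resulting inequalities add up to
  \<open>L \<le> lam\<close>, which leaves no room for a positive value of either semidefinite
  pencil form at \<open>u\<close> or \<open>v\<close>.\<close>

lemma kernel_of_separate_minimum:
  assumes sym: "symmetric_mat A1" "symmetric_mat B1" "symmetric_mat C1"
      "symmetric_mat A2" "symmetric_mat B2" "symmetric_mat C2"
    and C1: "\<And>u. u \<noteq> 0 \<Longrightarrow> quad_form C1 u < 0" and C2: "\<And>v. v \<noteq> 0 \<Longrightarrow> quad_form C2 v > 0"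
    and pos: "\<And>u v. u \<noteq> 0 \<Longrightarrow> v \<noteq> 0 \<Longrightarrow>
      quad_form C1 u * quad_form B2 v - quad_form B1 u * quad_form C2 v > 0"
    and psd1: "\<And>x. quad_form (pencil A1 B1 C1 lam mu) x \<ge> 0"
    and psd2: "\<And>x. quad_form (pencil A2 B2 C2 lam mu) x \<ge> 0"
    and u0: "u0 \<noteq> 0" "pencil A1 B1 C1 lam mu *v u0 = 0"
    and v0: "v0 \<noteq> 0" "pencil A2 B2 C2 lam mu *v v0 = 0"
    and uv: "u \<noteq> 0" "v \<noteq> 0"
    and minu: "\<And>w. w \<noteq> 0 \<Longrightarrow> two_param_quotient A1 B1 C1 A2 B2 C2 u v \<le> two_param_quotient A1 B1 C1 A2 B2 C2 w v"
    and minv: "\<And>w. w \<noteq> 0 \<Longrightarrow> two_param_quotient A1 B1 C1 A2 B2 C2 u v \<le> two_param_quotient A1 B1 C1 A2 B2 C2 u w"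
  shows "pencil A1 B1 C1 lam mu *v u = 0 \<and> pencil A2 B2 C2 lam mu *v v = 0"
proof -
  let ?q = quad_form and ?D = "\<lambda>u v. quad_form C1 u * quad_form B2 v - quad_form B1 u * quad_form C2 v"
  define L where "L = two_param_quotient A1 B1 C1 A2 B2 C2 u v"
  \<comment> \<open>Chosen so that the first pencil form with parameters \<open>L\<close>,
    \<open>M\<close> vanishes at \<open>u\<close>; by the choice of \<open>L\<close> the second one
    then vanishes at \<open>v\<close>.\<close>
  define M where "M = - (?q A1 u + L * ?q B1 u) / ?q C1 u"
  have D0: "?D u v > 0" "?D u0 v0 > 0" using pos uv u0 v0 by auto
  have C: "?q C1 u < 0" "?q C2 v > 0" "?q C1 u0 < 0" "?q C2 v0 > 0" using C1 C2 uv u0 v0 by auto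
  have e1: "?q A1 u + L * ?q B1 u + M * ?q C1 u = 0"
    using C(1) by (simp add: M_def)
  have "L * ?D u v = ?q A1 u * ?q C2 v - ?q C1 u * ?q A2 v"
    using D0 by (simp add: L_def two_param_quotient_def)
  then have "?q C1 u * (?q A2 v + L * ?q B2 v + M * ?q C2 v) = ?q C2 v * (?q A1 u + L * ?q B1 u + M * ?q C1 u)"
    by (simp add: algebra_simps)
  then have e2: "?q A2 v + L * ?q B2 v + M * ?q C2 v = 0"
    using e1 C by simp
  have "L * ?D u0 v \<le> ?q A1 u0 * ?q C2 v - ?q C1 u0 * ?q A2 v"
    using minu[OF u0(1)] pos[OF u0(1) uv(2)] by (simp add: L_def[symmetric]) (simp add: two_param_quotient_def field_simps)
  then have "0 \<le> ?q C2 v * (?q A1 u0 + L * ?q B1 u0) - ?q C1 u0 * (?q A2 v + L * ?q B2 v)"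
    by (simp add: algebra_simps)
  also have "?q A2 v + L * ?q B2 v = - (M * ?q C2 v)" using e2 by simp
  finally have "0 \<le> ?q C2 v * (?q A1 u0 + L * ?q B1 u0 + M * ?q C1 u0)"
    by (simp add: algebra_simps)
  then have f1: "0 \<le> ?q A1 u0 + L * ?q B1 u0 + M * ?q C1 u0"
    using C by (simp add: zero_le_mult_iff)
  have "L * ?D u v0 \<le> ?q A1 u * ?q C2 v0 - ?q C1 u * ?q A2 v0"
    using minv[OF v0(1)] pos[OF uv(1) v0(1)] by (simp add: L_def[symmetric]) (simp add: two_param_quotient_def field_simps)
  then have "0 \<le> ?q C2 v0 * (?q A1 u + L * ?q B1 u) - ?q C1 u * (?q A2 v0 + L * ?q B2 v0)"
    by (simp add: algebra_simps)
  also have "?q A1 u + L * ?q B1 u = - (M * ?q C1 u)" using e1 by simp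
  finally have "0 \<le> - ?q C1 u * (?q A2 v0 + L * ?q B2 v0 + M * ?q C2 v0)"
    by (simp add: algebra_simps)
  then have f2: "0 \<le> ?q A2 v0 + L * ?q B2 v0 + M * ?q C2 v0"
    using C by (simp add: zero_le_mult_iff mult_le_0_iff)
  have z: "?q A1 u0 + lam * ?q B1 u0 + mu * ?q C1 u0 = 0" "?q A2 v0 + lam * ?q B2 v0 + mu * ?q C2 v0 = 0"
    using u0 v0 by (simp_all add: quad_form_pencil[symmetric]) (simp_all add: quad_form_def)
  \<comment> \<open>The weights \<open>?q C2 v0\<close> and \<open>- ?q C1 u0\<close> are positive
    and cancel the terms in \<open>M\<close> and in \<open>mu\<close>, so passing from
    \<open>(L, M)\<close> to \<open>(lam, mu)\<close> costs only a multiple of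
    \<open>lam - L\<close>.\<close>
  have "0 \<le> ?q C2 v0 * (?q A1 u0 + L * ?q B1 u0 + M * ?q C1 u0) + (- ?q C1 u0) * (?q A2 v0 + L * ?q B2 v0 + M * ?q C2 v0)"
    using f1 f2 C by (simp only: add_nonneg_nonneg mult_nonneg_nonneg less_imp_le neg_0_le_iff_le)
  also have "\<dots> = ?q C2 v0 * (?q A1 u0 + lam * ?q B1 u0 + mu * ?q C1 u0)
      - ?q C1 u0 * (?q A2 v0 + lam * ?q B2 v0 + mu * ?q C2 v0) + (lam - L) * ?D u0 v0"
    by (simp add: algebra_simps)
  also have "\<dots> = (lam - L) * ?D u0 v0" using z by simp
  finally have "L \<le> lam" using D0 by (simp add: zero_le_mult_iff)
  define p where "p = ?q (pencil A1 B1 C1 lam mu) u"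
  define r where "r = ?q (pencil A2 B2 C2 lam mu) v"
  have pr: "p \<ge> 0" "r \<ge> 0" using psd1 psd2 by (auto simp: p_def r_def)
  \<comment> \<open>The same elimination at \<open>(u, v)\<close>: now the forms with parameters
    \<open>L\<close>, \<open>M\<close> vanish, so a positively weighted sum of the nonnegative
    \<open>p\<close> and \<open>r\<close> is at most 0.\<close>
  have "?q C2 v * p + (- ?q C1 u) * r = ?q C2 v * (?q A1 u + L * ?q B1 u + M * ?q C1 u)
      - ?q C1 u * (?q A2 v + L * ?q B2 v + M * ?q C2 v) + (L - lam) * ?D u v"
    by (simp add: p_def r_def quad_form_pencil algebra_simps)
  also have "\<dots> \<le> 0" using e1 e2 D0 \<open>L \<le> lam\<close> by (simp add: mult_le_0_iff)
  finally have le0: "?q C2 v * p + (- ?q C1 u) * r \<le> 0" .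
  have "?q C2 v * p \<ge> 0" "(- ?q C1 u) * r \<ge> 0"
    using pr C by (auto intro!: mult_nonneg_nonneg mult_nonpos_nonneg simp: mult_le_0_iff)
  then have "?q C2 v * p = 0" "(- ?q C1 u) * r = 0" using le0 by linarith+
  then have "p = 0" "r = 0" using C by auto
  then show ?thesis
    using psd1 psd2 sym unfolding p_def r_def
    by (auto intro!: quad_form_eq_0_imp_kernel symmetric_mat_simps simp: pencil_def)
qed

text \<open>Of the algorithm only the minimality of each half-step is kept, and of the index only
  semidefiniteness of the pencils. In this form it serves both index pairs, the second one after a
  sign change.\<close>

lemma alternating_minimization_converges:
  fixes A1 B1 C1 :: "real^'n^'n" and A2 B2 C2 :: "real^'m^'m"
  assumes sym: "symmetric_mat A1" "symmetric_mat B1" "symmetric_mat C1"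
      "symmetric_mat A2" "symmetric_mat B2" "symmetric_mat C2"
    and C1: "\<And>u. u \<noteq> 0 \<Longrightarrow> quad_form C1 u < 0" and C2: "\<And>v. v \<noteq> 0 \<Longrightarrow> quad_form C2 v > 0"
    and pos: "\<And>u v. u \<noteq> 0 \<Longrightarrow> v \<noteq> 0 \<Longrightarrow>
      quad_form C1 u * quad_form B2 v - quad_form B1 u * quad_form C2 v > 0"
    and psd1: "\<And>x. quad_form (pencil A1 B1 C1 lam mu) x \<ge> 0"
    and psd2: "\<And>x. quad_form (pencil A2 B2 C2 lam mu) x \<ge> 0"
    and dim1: "dim (mat_kernel (pencil A1 B1 C1 lam mu)) = 1"
    and dim2: "dim (mat_kernel (pencil A2 B2 C2 lam mu)) = 1"
    and nz: "\<And>k. us k \<noteq> 0" "\<And>k. vs (Suc k) \<noteq> 0"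
    and minv: "\<And>k w. w \<noteq> 0 \<Longrightarrow> two_param_quotient A1 B1 C1 A2 B2 C2 (us k) (vs (Suc k))
      \<le> two_param_quotient A1 B1 C1 A2 B2 C2 (us k) w"
    and minu: "\<And>k w. w \<noteq> 0 \<Longrightarrow> two_param_quotient A1 B1 C1 A2 B2 C2 (us (Suc k)) (vs (Suc k))
      \<le> two_param_quotient A1 B1 C1 A2 B2 C2 w (vs (Suc k))"
  obtains u v s t where "norm u = 1" "norm v = 1"
    "\<And>k. s k \<in> {-1, 1 :: real}" "\<And>k. t k \<in> {-1, 1 :: real}"
    "(\<lambda>k. s k *\<^sub>R (us k /\<^sub>R norm (us k))) \<longlonglongrightarrow> u" "(\<lambda>k. t k *\<^sub>R (vs k /\<^sub>R norm (vs k))) \<longlonglongrightarrow> v"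
    "pencil A1 B1 C1 lam mu *v u = 0" "pencil A2 B2 C2 lam mu *v v = 0"
proof -
  let ?\<rho> = "two_param_quotient A1 B1 C1 A2 B2 C2"
  define U where "U k = us k /\<^sub>R norm (us k)" for k
  \<comment> \<open>Shifted by one, since \<open>vs 0\<close> is unconstrained: \<open>V k\<close>
    is the minimizer belonging to \<open>U k\<close>, and \<open>U (Suc k)\<close> the one belonging
    to \<open>V k\<close>.\<close>
  define V where "V k = vs (Suc k) /\<^sub>R norm (vs (Suc k))" for k
  have norms: "norm (U k) = 1" "norm (V k) = 1" for k
    using nz by (auto simp: U_def V_def)
  have nzUV: "U k \<noteq> 0" "V k \<noteq> 0" for k
    using norms(1)[of k] norms(2)[of k] by auto
  have scaleU: "?\<rho> (us k) w = ?\<rho> (U k) w" and scaleV: "?\<rho> w' (vs (Suc k)) = ?\<rho> w' (V k)" for k w w'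
    using two_param_quotient_scaleR[of "inverse (norm (us k))" 1 A1 B1 C1 A2 B2 C2 "us k" w]
      two_param_quotient_scaleR[of 1 "inverse (norm (vs (Suc k)))" A1 B1 C1 A2 B2 C2 w' "vs (Suc k)"] nz
    by (simp_all add: U_def V_def)
  have minV: "?\<rho> (U k) (V k) \<le> ?\<rho> (U k) w" if "w \<noteq> 0" for k w
    using minv[OF that, of k] by (simp only: scaleU scaleV)
  have minU: "?\<rho> (U (Suc k)) (V k) \<le> ?\<rho> w (V k)" if "w \<noteq> 0" for k w
    using minu[OF that, of k] by (simp only: scaleU scaleV)
  have lower: "lam \<le> ?\<rho> u v" if "u \<noteq> 0" "v \<noteq> 0" for u v
  proof -
    \<comment> \<open>These nonnegative weights cancel \<open>mu\<close> and leave the numerator of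
      the quotient minus \<open>lam\<close> times its denominator.\<close>
    have "0 \<le> quad_form C2 v * quad_form (pencil A1 B1 C1 lam mu) u
        + (- quad_form C1 u) * quad_form (pencil A2 B2 C2 lam mu) v"
      using C1[OF that(1)] C2[OF that(2)] psd1 psd2 by (intro add_nonneg_nonneg mult_nonneg_nonneg) auto
    then have "lam * (quad_form C1 u * quad_form B2 v - quad_form B1 u * quad_form C2 v)
        \<le> quad_form A1 u * quad_form C2 v - quad_form C1 u * quad_form A2 v"
      by (simp add: quad_form_pencil algebra_simps)
    then show ?thesis
      using pos[OF that] by (simp add: two_param_quotient_def pos_le_divide_eq)
  qed
  have step: "?\<rho> (U (Suc k)) (V (Suc k)) \<le> ?\<rho> (U (Suc k)) (V k)" "?\<rho> (U (Suc k)) (V k) \<le> ?\<rho> (U k) (V k)" for k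
    using minV minU nzUV by blast+
  have "decseq (\<lambda>k. ?\<rho> (U k) (V k))"
    by (intro decseq_SucI order_trans[OF step])
  then obtain L where L: "(\<lambda>k. ?\<rho> (U k) (V k)) \<longlonglongrightarrow> L"
    by (rule decseq_convergent[where B = lam]) (use lower nzUV in auto)
  \<comment> \<open>The values after a half-step lie between consecutive full-step values.\<close>
  have L': "(\<lambda>k. ?\<rho> (U (Suc k)) (V k)) \<longlonglongrightarrow> L"
    by (rule tendsto_sandwich[OF _ _ LIMSEQ_Suc[OF L] L]) (use step in auto)
  have cont: "(\<lambda>k. ?\<rho> (f k) (g k)) \<longlonglongrightarrow> ?\<rho> x y"
    if "f \<longlonglongrightarrow> x" "g \<longlonglongrightarrow> y" "x \<noteq> 0" "y \<noteq> 0" for f g x y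
    using pos[OF that(3,4)] unfolding two_param_quotient_def by (intro tendsto_intros that) auto
  obtain u0 where u0: "u0 \<in> mat_kernel (pencil A1 B1 C1 lam mu)" "norm u0 = 1"
      "\<And>x. x \<in> mat_kernel (pencil A1 B1 C1 lam mu) \<Longrightarrow> norm x = 1 \<Longrightarrow> \<bar>x \<bullet> u0\<bar> = 1"
    using unit_vector_of_1dim_subspace[OF subspace_mat_kernel dim1] by blast
  obtain v0 where v0: "v0 \<in> mat_kernel (pencil A2 B2 C2 lam mu)" "norm v0 = 1"
      "\<And>x. x \<in> mat_kernel (pencil A2 B2 C2 lam mu) \<Longrightarrow> norm x = 1 \<Longrightarrow> \<bar>x \<bullet> v0\<bar> = 1"
    using unit_vector_of_1dim_subspace[OF subspace_mat_kernel dim2] by blast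
  define K where "K = sphere (0 :: real^'n) 1 \<times> sphere (0 :: real^'m) 1"
  have K: "compact K" by (auto simp: K_def compact_Times)
  have UVK: "(U k, V k) \<in> K" for k by (simp add: K_def norms)
  have lim: "\<bar>fst x \<bullet> u0\<bar> = 1 \<and> \<bar>snd x \<bullet> v0\<bar> = 1"
    if r: "strict_mono r" and x: "x \<in> K" "((\<lambda>k. (U k, V k)) \<circ> r) \<longlonglongrightarrow> x" for r x
  proof -
    obtain u v where uv: "x = (u, v)" "norm u = 1" "norm v = 1"
      using x by (auto simp: K_def)
    then have nz: "u \<noteq> 0" "v \<noteq> 0" by auto
    have Ulim: "(\<lambda>k. U (r k)) \<longlonglongrightarrow> u" and Vlim: "(\<lambda>k. V (r k)) \<longlonglongrightarrow> v"
      using tendsto_fst[OF x(2)] tendsto_snd[OF x(2)] uv by (simp_all add: o_def)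
    have "?\<rho> u v = L"
      using LIMSEQ_unique[OF cont[OF Ulim Vlim nz]] LIMSEQ_subseq_LIMSEQ[OF L r] by (simp add: o_def)
    \<comment> \<open>Minimality in the first variable holds at \<open>U (Suc (r k))\<close>, which
      need not converge. It suffices that the quotient values there tend to \<open>L\<close>, which
      is the value at \<open>(u, v)\<close>.\<close>
    then have "?\<rho> u v \<le> ?\<rho> w v" if "w \<noteq> 0" for w
      using LIMSEQ_le[OF LIMSEQ_subseq_LIMSEQ[OF L' r] cont[OF tendsto_const Vlim that nz(2)]]
        minU[OF that] by (auto simp: o_def)
    moreover have "?\<rho> u v \<le> ?\<rho> u w" if "w \<noteq> 0" for w
      using LIMSEQ_le[OF cont[OF Ulim Vlim nz] cont[OF Ulim tendsto_const nz(1) that]]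
        minV[OF that] by auto
    ultimately have "pencil A1 B1 C1 lam mu *v u = 0 \<and> pencil A2 B2 C2 lam mu *v v = 0"
      by (intro kernel_of_separate_minimum[OF sym C1 C2 pos psd1 psd2 _ _ _ _ nz, of u0 v0])
        (use u0 v0 in \<open>auto simp: mat_kernel_def\<close>)
    then show ?thesis using u0(3)[of u] v0(3)[of v] uv by (simp add: mat_kernel_def)
  qed
  \<comment> \<open>The absolute inner product with \<open>u0\<close> does not see the sign and
    equals 1 at every limit point.\<close>
  have "(\<lambda>k. \<bar>fst (U k, V k) \<bullet> u0\<bar>) \<longlonglongrightarrow> 1"
    by (rule subsequential_limits_imp_tendsto[OF K UVK]) (use lim in \<open>auto intro!: continuous_intros\<close>)
  then obtain s where s: "\<And>k. s k \<in> {-1, 1 :: real}" "(\<lambda>k. s k *\<^sub>R U k) \<longlonglongrightarrow> u0"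
    using unit_vectors_tendsto_up_to_sign[of U u0] norms u0(2) by auto
  have "(\<lambda>k. \<bar>snd (U k, V k) \<bullet> v0\<bar>) \<longlonglongrightarrow> 1"
    by (rule subsequential_limits_imp_tendsto[OF K UVK]) (use lim in \<open>auto intro!: continuous_intros\<close>)
  then obtain t where t: "\<And>k. t k \<in> {-1, 1 :: real}" "(\<lambda>k. t k *\<^sub>R V k) \<longlonglongrightarrow> v0"
    using unit_vectors_tendsto_up_to_sign[of V v0] norms v0(2) by auto
  \<comment> \<open>Undoes the shift in \<open>V\<close>; the sign 1 at index 0 is arbitrary and
    does not affect the limit.\<close>
  define t' where "t' k = (case k of 0 \<Rightarrow> 1 | Suc l \<Rightarrow> t l)" for k
  have "(\<lambda>k. t' k *\<^sub>R (vs k /\<^sub>R norm (vs k))) \<longlonglongrightarrow> v0"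
    by (rule LIMSEQ_imp_Suc) (use t(2) in \<open>simp add: t'_def V_def\<close>)
  moreover have "t' k \<in> {-1, 1}" for k using t(1) by (auto simp: t'_def split: nat.split)
  ultimately show ?thesis
    using that[of u0 v0 s t'] u0 v0 s by (auto simp: U_def mat_kernel_def)
qed

section \<open>Sign reversal and the convergence theorem\<close>

lemma pencil_uminus: "pencil (- A) B C (- lam) (- mu) = - pencil A B C lam mu"
  by (simp add: pencil_def)

lemma two_param_quotient_uminus:
  "two_param_quotient (- A1) B1 C1 (- A2) B2 C2 u v = - two_param_quotient A1 B1 C1 A2 B2 C2 u v"
  by (simp add: two_param_quotient_def quad_form_simps minus_divide_left)

theorem theorem12:
  fixes A1 B1 C1 :: "real^'n^'n" and A2 B2 C2 :: "real^'m^'m"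
    and i j :: nat and lam0 mu0 :: real
    and us :: "nat \<Rightarrow> real^'n" and vs :: "nat \<Rightarrow> real^'m"
  assumes "symmetric_mat A1" "symmetric_mat B1" "symmetric_mat C1"
    and "symmetric_mat A2" "symmetric_mat B2" "symmetric_mat C2"
    and "pos_def C2"
    and "pos_def (C1 \<otimes>\<^sub>K B2 - B1 \<otimes>\<^sub>K C2)"
    and "neg_def C1"
    and "(i, j) = (1, 1) \<or> (i, j) = (CARD('n), CARD('m))"
    and "eigenvalue_of_index A1 B1 C1 A2 B2 C2 i j lam0 mu0"
    and "simple_eigenvalue A1 B1 C1 A2 B2 C2 lam0 mu0"
    and "alternating_algorithm A1 B1 C1 A2 B2 C2 i j us vs"
  shows "\<exists>(u :: real^'n) (v :: real^'m) (s :: nat \<Rightarrow> real) (t :: nat \<Rightarrow> real) (lam :: real) (mu :: real).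
           norm u = 1 \<and> norm v = 1 \<and>
           (\<forall>k. s k \<in> {-1, 1}) \<and> (\<forall>k. t k \<in> {-1, 1}) \<and>
           (\<lambda>k. s k *\<^sub>R (us k /\<^sub>R norm (us k))) \<longlonglongrightarrow> u \<and>
           (\<lambda>k. t k *\<^sub>R (vs k /\<^sub>R norm (vs k))) \<longlonglongrightarrow> v \<and>
           (A1 + lam *\<^sub>R B1 + mu *\<^sub>R C1) *v u = 0 \<and>
           (A2 + lam *\<^sub>R B2 + mu *\<^sub>R C2) *v v = 0"
proof -
  let ?\<rho> = "two_param_quotient A1 B1 C1 A2 B2 C2"
  note sym = assms(1-6)
  have C1: "quad_form C1 u < 0" if "u \<noteq> 0" for u using assms(9) that by (simp add: neg_def_def)
  have C2: "quad_form C2 v > 0" if "v \<noteq> 0" for v using assms(7) that by (simp add: pos_def_def)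
  have pos: "quad_form C1 u * quad_form B2 v - quad_form B1 u * quad_form C2 v > 0"
    if "u \<noteq> 0" "v \<noteq> 0" for u v using pos_def_kronecker_diff assms(8) that by blast
  have dims: "dim (mat_kernel (pencil A1 B1 C1 lam0 mu0)) = 1"
      "dim (mat_kernel (pencil A2 B2 C2 lam0 mu0)) = 1"
    using assms(12) by (auto simp: simple_eigenvalue_def)
  have ind: "ith_smallest_eigenvalue i (pencil A1 B1 C1 lam0 mu0) (mat 1) 0"
      "ith_smallest_eigenvalue j (pencil A2 B2 C2 lam0 mu0) (mat 1) 0"
    using assms(11) by (auto simp: eigenvalue_of_index_def)
  have symP: "symmetric_mat (pencil A1 B1 C1 lam0 mu0)" "symmetric_mat (pencil A2 B2 C2 lam0 mu0)"
    using sym by (auto simp: pencil_def intro!: symmetric_mat_simps)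
  have symI: "symmetric_mat (mat 1)" by (rule symmetric_mat_simps)
  have posI: "x \<noteq> 0 \<Longrightarrow> quad_form (mat 1) x > 0" for x :: "real^'k" by (simp add: quad_form_simps)
  have vstep: "v_step A1 B1 C1 A2 B2 C2 j (us k) (vs (Suc k))"
    and ustep: "u_step A1 B1 C1 A2 B2 C2 i (vs (Suc k)) (us (Suc k))" for k
    using assms(13) by (auto simp: alternating_algorithm_def dest: spec[of _ "Suc k"])
  have us_nz: "us k \<noteq> 0" for k
    using assms(13) ustep by (cases k) (auto simp: alternating_algorithm_def u_step_def Let_def)
  have vs_nz: "vs (Suc k) \<noteq> 0" for k
    using vstep[of k] by (auto simp: v_step_def Let_def)
  let ?MV = "\<lambda>u. quad_form A1 u *\<^sub>R C2 - quad_form C1 u *\<^sub>R A2"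
  let ?NV = "\<lambda>u. quad_form C1 u *\<^sub>R B2 - quad_form B1 u *\<^sub>R C2"
  let ?MU = "\<lambda>v. quad_form C2 v *\<^sub>R A1 - quad_form A2 v *\<^sub>R C1"
  let ?NU = "\<lambda>v. quad_form B2 v *\<^sub>R C1 - quad_form C2 v *\<^sub>R B1"
  have symV: "symmetric_mat (?MV u)" "symmetric_mat (?NV u)"
    and symU: "symmetric_mat (?MU v)" "symmetric_mat (?NU v)" for u v
    using sym by (auto intro!: symmetric_mat_simps)
  have posV: "v \<noteq> 0 \<Longrightarrow> quad_form (?NV u) v > 0" if "u \<noteq> 0" for u v
    using pos[OF that] by (simp add: quad_form_simps)
  have posU: "u \<noteq> 0 \<Longrightarrow> quad_form (?NU v) u > 0" if "v \<noteq> 0" for u v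
    using pos[OF _ that] by (simp add: quad_form_simps mult.commute)
  \<comment> \<open>With one variable fixed, the quotient is the ordinary Rayleigh quotient of the
    generalized eigenvalue problem solved in the other half-step. Its value at the new iterate is
    therefore the selected eigenvalue.\<close>
  have rhoV: "?\<rho> u v = quad_form (?MV u) v / quad_form (?NV u) v"
    and rhoU: "?\<rho> u v = quad_form (?MU v) u / quad_form (?NU v) u" for u v
    by (simp_all add: two_param_quotient_def quad_form_simps mult.commute)
  have quad_eigen: "quad_form M x = \<kappa> * quad_form N x" if "x \<in> eigenspace M N \<kappa>" for M N :: "real^'k^'k" and x \<kappa>
    using that by (simp add: eigenspace_def quad_form_def)
  have V: "ith_smallest_eigenvalue j (?MV (us k)) (?NV (us k)) (?\<rho> (us k) (vs (Suc k)))" for k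
  proof -
    obtain \<kappa> where \<kappa>: "ith_smallest_eigenvalue j (?MV (us k)) (?NV (us k)) \<kappa>"
        "vs (Suc k) \<in> eigenspace (?MV (us k)) (?NV (us k)) \<kappa>"
      using vstep[of k] by (auto simp: v_step_def Let_def)
    have "?\<rho> (us k) (vs (Suc k)) = \<kappa>"
      using posV[OF us_nz vs_nz, of k k] quad_eigen[OF \<kappa>(2)] by (simp add: rhoV)
    then show ?thesis using \<kappa> by simp
  qed
  have U: "ith_smallest_eigenvalue i (?MU (vs (Suc k))) (?NU (vs (Suc k))) (?\<rho> (us (Suc k)) (vs (Suc k)))" for k
  proof -
    obtain \<kappa> where \<kappa>: "ith_smallest_eigenvalue i (?MU (vs (Suc k))) (?NU (vs (Suc k))) \<kappa>"
        "us (Suc k) \<in> eigenspace (?MU (vs (Suc k))) (?NU (vs (Suc k))) \<kappa>"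
      using ustep[of k] by (auto simp: u_step_def Let_def)
    have "?\<rho> (us (Suc k)) (vs (Suc k)) = \<kappa>"
      using posU[OF vs_nz us_nz, of k "Suc k"] quad_eigen[OF \<kappa>(2)] by (simp add: rhoU)
    then show ?thesis using \<kappa> by simp
  qed
  have "\<exists>u v s t. norm u = 1 \<and> norm v = 1 \<and> (\<forall>k. s k \<in> {-1, 1 :: real}) \<and> (\<forall>k. t k \<in> {-1, 1 :: real}) \<and>
      (\<lambda>k. s k *\<^sub>R (us k /\<^sub>R norm (us k))) \<longlonglongrightarrow> u \<and> (\<lambda>k. t k *\<^sub>R (vs k /\<^sub>R norm (vs k))) \<longlonglongrightarrow> v \<and>
      pencil A1 B1 C1 lam0 mu0 *v u = 0 \<and> pencil A2 B2 C2 lam0 mu0 *v v = 0"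
    using assms(10)
  proof
    assume ij: "(i, j) = (1, 1)"
    have ij': "i = 1" "j = 1" using ij by auto
    have minV: "?\<rho> (us k) (vs (Suc k)) \<le> ?\<rho> (us k) w" if "w \<noteq> 0" for k w
      using smallest_eigenvalue_le[OF symV _ V[of k, unfolded ij'], of w] posV[OF us_nz] posV[OF us_nz that, of k]
      unfolding rhoV[of _ w] by (simp add: pos_le_divide_eq)
    have minU: "?\<rho> (us (Suc k)) (vs (Suc k)) \<le> ?\<rho> w (vs (Suc k))" if "w \<noteq> 0" for k w
      using smallest_eigenvalue_le[OF symU _ U[of k, unfolded ij'], of w] posU[OF vs_nz] posU[OF vs_nz that, of k]
      unfolding rhoU[of w] by (simp add: pos_le_divide_eq)
    \<comment> \<open>By the index \<open>(1, 1)\<close>, 0 is the smallest eigenvalue of both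
      pencils.\<close>
    have psd: "quad_form (pencil A1 B1 C1 lam0 mu0) x \<ge> 0" "quad_form (pencil A2 B2 C2 lam0 mu0) y \<ge> 0" for x y
      using smallest_eigenvalue_le[OF symP(1) symI posI ind(1)[unfolded ij'], of x]
        smallest_eigenvalue_le[OF symP(2) symI posI ind(2)[unfolded ij'], of y] by auto
    show ?thesis
      by (rule alternating_minimization_converges[where us = us and vs = vs,
          OF sym C1 C2 pos psd dims us_nz vs_nz minV minU]) blast+
  next
    assume ij: "(i, j) = (CARD('n), CARD('m))"
    have ij': "i = CARD('n)" "j = CARD('m)" using ij by auto
    \<comment> \<open>Negating \<open>A1\<close>, \<open>A2\<close> and both parameters negates the
      pencils and the quotient but keeps the right-hand sides, so largest eigenvalues turn into
      minima.\<close>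
    let ?\<rho>' = "two_param_quotient (- A1) B1 C1 (- A2) B2 C2"
    have minV: "?\<rho>' (us k) (vs (Suc k)) \<le> ?\<rho>' (us k) w" if "w \<noteq> 0" for k w
      using largest_eigenvalue_ge[OF symV _ V[of k, unfolded ij'], of w] posV[OF us_nz] posV[OF us_nz that, of k]
      unfolding two_param_quotient_uminus rhoV[of _ w] by (simp add: pos_divide_le_eq)
    have minU: "?\<rho>' (us (Suc k)) (vs (Suc k)) \<le> ?\<rho>' w (vs (Suc k))" if "w \<noteq> 0" for k w
      using largest_eigenvalue_ge[OF symU _ U[of k, unfolded ij'], of w] posU[OF vs_nz] posU[OF vs_nz that, of k]
      unfolding two_param_quotient_uminus rhoU[of w] by (simp add: pos_divide_le_eq)
    have psd: "quad_form (pencil (- A1) B1 C1 (- lam0) (- mu0)) x \<ge> 0"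
        "quad_form (pencil (- A2) B2 C2 (- lam0) (- mu0)) y \<ge> 0" for x y
      using largest_eigenvalue_ge[OF symP(1) symI posI ind(1)[unfolded ij'], of x]
        largest_eigenvalue_ge[OF symP(2) symI posI ind(2)[unfolded ij'], of y] by (auto simp: pencil_uminus quad_form_simps)
    have dims': "dim (mat_kernel (pencil (- A1) B1 C1 (- lam0) (- mu0))) = 1"
        "dim (mat_kernel (pencil (- A2) B2 C2 (- lam0) (- mu0))) = 1"
      using dims by (simp_all add: pencil_uminus mat_kernel_def matrix_vector_mult_uminus_left)
    have sym': "symmetric_mat (- A1)" "symmetric_mat (- A2)"
      using sym by (auto intro: symmetric_mat_simps)
    \<comment> \<open>Kernels are unchanged by the sign, so the limits solve the original problem at
      \<open>(lam0, mu0)\<close>.\<close>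
    have ker: "pencil (- A) B C (- lam0) (- mu0) *v x = 0 \<longleftrightarrow> pencil A B C lam0 mu0 *v x = 0"
      for A B C :: "real^'k^'k" and x
      by (simp add: pencil_uminus matrix_vector_mult_uminus_left)
    show ?thesis
      by (rule alternating_minimization_converges[where us = us and vs = vs,
          OF sym'(1) sym(2,3) sym'(2) sym(5,6) C1 C2 pos psd dims' us_nz vs_nz minV minU, unfolded ker]) blast+
  qed
  then show ?thesis unfolding pencil_def by blast
qed

end
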